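(* Let $\ell\ge 1$ and $u\ge \ell + \log\ell$ be integers, and let $n\coloneqq 2^\ell$. Let $S\subset\mathbb{F}_2^{u}$ have cardinality $n$, and let $\mathcal{H}$ be the set of all surjective linear maps $\mathbb{F}_2^{u}\to\mathbb{F}_2^\ell$. For any $r\ge 1$, if $h$ is drawn uniformly at random from $\mathcal{H}$, \[\Pr_{h\sim \mathcal{H}}\left[M(S,h) \ge r\cdot \frac{\log n}{\log\log n}\right] \le \frac{3\log e}{2(r-1)}.\]
   Context: $\log$ denotes the base-2 logarithm. For a map $h:A\to B$ and $S\subset A$, $M(S,h)\coloneqq \max_{y\in B}|h^{-1}(y)\cap S|$. *)

theory Defs
  imports "HOL-Probability.Probability" "HOL-Library.Z2"
begin

instance bit :: finite
proof
  have "(UNIV :: bit set) \<subseteq> {0, 1}"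
    by (auto intro: bit_not_one_iff[THEN iffD1])
  then show "finite (UNIV :: bit set)"
    by (rule finite_subset) simp
qed

definition max_load :: "'a set \<Rightarrow> ('a \<Rightarrow> 'b::finite) \<Rightarrow> nat" where
  "max_load S h = Max (range (\<lambda>y. card (h -` {y} \<inter> S)))"

definition surj_linear_maps :: "('k::field ^ 'm \<Rightarrow> 'k ^ 'n) set" where
  "surj_linear_maps = {h. Vector_Spaces.linear (*s) (*s) h \<and> surj h}"

text \<open>
  The real quotients \<open>log n / log (log n)\<close> and \<open>3 log e / (2 (r - 1))\<close> have denominator zero for
  \<open>n = 2\<close> and \<open>r = 1\<close> respectively. They are therefore taken in \<^typ>\<open>ereal\<close>, where a positive
  number divided by zero is \<open>\<infinity>\<close>, and not in \<^typ>\<open>real\<close>, where it would be \<open>0\<close>.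
\<close>

definition load_scale :: "nat \<Rightarrow> ereal" where
  "load_scale n = ereal (log 2 (real n)) / ereal (log 2 (log 2 (real n)))"

end

(*
  For a subspace W put Phi(W) = E_x [C ^ card (S \<inter> (x + W))], with C = l. Enlarging W by a vector v
  replaces the load g(x) of a coset by g(x) + g(x + v), so averaging over v \<notin> W gives at most
  Phi(W)^2, and by Jensen ln Phi at most doubles in expectation. Building the kernel of h one vector
  at a time from {0}, where Phi = 1 + (C - 1) n / 2^u, gives E [ln Phi(ker h)] \<le> C - 1. Since
  Phi(ker h) \<ge> C ^ M(S,h) / 2^l, Markov's inequality applied to ln Phi bounds the tail of M(S,h).
*)

theory Submission
  imports Defs
begin

section \<open>Subspaces over the field with two elements\<close>

lemma CARD_bit [simp]: "CARD(bit) = 2"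
proof -
  have "(UNIV :: bit set) = {0, 1}"
    by (auto intro: bit_not_one_iff[THEN iffD1])
  then have "CARD(bit) = card {0, 1 :: bit}" by (rule arg_cong)
  then show ?thesis by simp
qed

lemma bit_vec_add_self [simp]: "x + x = (0 :: bit ^ 'n)"
  by (simp add: vec_eq_iff)

lemma bit_vec_add_self_left [simp]: "x + (x + y) = (y :: bit ^ 'n)"
  by (simp add: add.assoc[symmetric])

lemma bit_vec_minus_eq_plus: "x - y = (x + y :: bit ^ 'n)"
  by (simp add: vec_eq_iff)

lemma bit_vec_add_eq_0_iff: "x + y = 0 \<longleftrightarrow> x = (y :: bit ^ 'n)"
  by (metis bit_vec_minus_eq_plus eq_iff_diff_eq_0)

lemma bij_add_left: "bij ((+) (x :: 'a::group_add))"
  by (simp add: bij_def inj_on_def)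

text \<open>The only scalars are 0 and 1, so closure under scaling follows from
  \<open>0 \<in> W\<close>.\<close>

lemma subspace_bit_iff:
  "vec.subspace (W :: (bit ^ 'n) set) \<longleftrightarrow> 0 \<in> W \<and> (\<forall>x\<in>W. \<forall>y\<in>W. x + y \<in> W)"
proof -
  have "c *s x \<in> W" if "0 \<in> W" "x \<in> W" for c :: bit and x
    by (cases c) (use that in auto)
  then show ?thesis
    by (auto simp: vec.subspace_def)
qed

lemma subspace_add_iff:
  assumes "vec.subspace (W :: (bit ^ 'n) set)" "w \<in> W"
  shows "w + x \<in> W \<longleftrightarrow> x \<in> W" "x + w \<in> W \<longleftrightarrow> x \<in> W"
  using assms by (metis bit_vec_add_self_left subspace_bit_iff add.commute)+

text \<open>For a subspace \<open>W\<close> this is the span of \<open>W\<close> and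
  \<open>v\<close>. The second set is the coset v + W, written as a preimage because v + v =
  0.\<close>

definition extend :: "(bit ^ 'n) set \<Rightarrow> bit ^ 'n \<Rightarrow> (bit ^ 'n) set" where
  "extend W v = W \<union> {x. v + x \<in> W}"

lemma subspace_extend:
  assumes "vec.subspace W"
  shows "vec.subspace (extend W v)"
proof -
  have "x + y \<in> extend W v" if "x \<in> extend W v" "y \<in> extend W v" for x y
  proof -
    \<comment> \<open>One regrouping for each way that x or y can lie in the translate; when both
      do, the two copies of \<open>v\<close> cancel.\<close>
    have "v + (x + y) = (v + x) + y" "v + (x + y) = x + (v + y)" "x + y = (v + x) + (v + y)"
      by (simp_all add: algebra_simps)
    then show ?thesis
      using that assms unfolding extend_def subspace_bit_iff by (metis Un_iff mem_Collect_eq)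
  qed
  then show ?thesis
    using assms by (auto simp: extend_def subspace_bit_iff)
qed

lemma extend_disjoint:
  assumes "vec.subspace (W :: (bit ^ 'n) set)" "v \<notin> W"
  shows "W \<inter> {x. v + x \<in> W} = {}"
  using assms subspace_add_iff(2) by blast

lemma card_extend:
  assumes "vec.subspace W" "v \<notin> W"
  shows "card (extend W v) = 2 * card W"
proof -
  have "{x. v + x \<in> W} = (+) v ` W"
    by (auto simp: image_iff) (metis bit_vec_add_self_left)
  then have "card {x. v + x \<in> W} = card W"
    by (simp add: card_image)
  then show ?thesis
    unfolding extend_def using extend_disjoint[OF assms] by (subst card_Un_disjoint) auto
qed

section \<open>Surjective linear maps that vanish on a subspace\<close>

definition linear_kernel :: "('a \<Rightarrow> 'b::zero) \<Rightarrow> 'a set" where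
  "linear_kernel h = {x. h x = 0}"

text \<open>A uniform element of this set is a random surjection conditioned on its kernel
  containing \<open>W\<close>; enlarging \<open>W\<close> reveals the kernel step by step.\<close>

definition surj_vanishing :: "(bit ^ 'm) set \<Rightarrow> (bit ^ 'm \<Rightarrow> bit ^ 'n) set" where
  "surj_vanishing W = {h \<in> surj_linear_maps. W \<subseteq> linear_kernel h}"

lemma surj_linear_maps_add: "h \<in> surj_linear_maps \<Longrightarrow> h (x + y) = h x + h y"
  by (simp add: surj_linear_maps_def Vector_Spaces.linear_iff)

lemma surj_linear_maps_0: "h \<in> surj_linear_maps \<Longrightarrow> h 0 = 0"
  using surj_linear_maps_add[of h 0 0] by simp

text \<open>Selecting coordinates along an injection of the index types is surjective. Nonemptiness
  is what gives \<open>pmf_of_set\<close> its meaning as the uniform distribution.\<close>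

lemma surj_linear_maps_nonempty:
  assumes "CARD('n) \<le> CARD('m)"
  shows "(surj_linear_maps :: ('k::field ^ 'm \<Rightarrow> 'k ^ 'n) set) \<noteq> {}"
proof -
  obtain f :: "'n \<Rightarrow> 'm" where f: "inj f"
    using card_le_inj[of "UNIV :: 'n set" "UNIV :: 'm set"] assms by auto
  define h :: "'k ^ 'm \<Rightarrow> 'k ^ 'n" where "h x = (\<chi> i. x $ f i)" for x
  have "Vector_Spaces.linear (*s) (*s) h"
    unfolding Vector_Spaces.linear_iff by (simp add: h_def vec_eq_iff vec.vector_space_axioms)
  moreover have "h (\<chi> j. y $ inv f j) = y" for y
    using f by (simp add: h_def vec_eq_iff)
  then have "surj h" by (rule surjI)
  ultimately show ?thesis by (auto simp: surj_linear_maps_def)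
qed

lemma subspace_linear_kernel:
  "h \<in> surj_linear_maps \<Longrightarrow> vec.subspace (linear_kernel (h :: bit ^ 'm \<Rightarrow> bit ^ 'n))"
  by (simp add: subspace_bit_iff linear_kernel_def surj_linear_maps_add surj_linear_maps_0)

text \<open>A right inverse of \<open>h\<close> splits every point uniquely into a representative of
  its fibre and a kernel element.\<close>

lemma card_linear_kernel:
  fixes h :: "bit ^ 'm \<Rightarrow> bit ^ 'n"
  assumes h: "h \<in> surj_linear_maps"
  shows "card (linear_kernel h) * 2 ^ CARD('n) = 2 ^ CARD('m)"
proof -
  have s: "h (inv h y) = y" for y
    using h by (simp add: surj_linear_maps_def surj_f_inv_f)
  have "bij_betw (\<lambda>(y, k). inv h y + k) (UNIV \<times> linear_kernel h) UNIV"
    by (rule bij_betw_byWitness[where f' = "\<lambda>x. (h x, inv h (h x) + x)"])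
       (auto simp: s linear_kernel_def surj_linear_maps_add[OF h])
  from bij_betw_same_card[OF this] show ?thesis
    by (simp add: card_cartesian_product mult.commute)
qed

lemma surj_vanishing_extend:
  "vec.subspace W \<Longrightarrow> surj_vanishing (extend W v) = {h \<in> surj_vanishing W. h v = 0}"
proof (intro set_eqI iffI)
  fix h :: "bit ^ 'a \<Rightarrow> bit ^ 'b"
  assume "vec.subspace W" and h: "h \<in> surj_vanishing (extend W v)"
  then have "v \<in> extend W v"
    by (simp add: extend_def subspace_bit_iff)
  moreover have "W \<subseteq> extend W v"
    by (simp add: extend_def)
  ultimately show "h \<in> {h \<in> surj_vanishing W. h v = 0}"
    using h unfolding surj_vanishing_def linear_kernel_def by blast
next
  fix h :: "bit ^ 'a \<Rightarrow> bit ^ 'b"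
  assume h: "h \<in> {h \<in> surj_vanishing W. h v = 0}"
  then have "h (v + x) = h x" for x
    by (simp add: surj_vanishing_def surj_linear_maps_add)
  with h show "h \<in> surj_vanishing (extend W v)"
    unfolding surj_vanishing_def extend_def linear_kernel_def by fastforce
qed

section \<open>Symmetry and double counting for maps vanishing on a subspace\<close>

text \<open>Over two elements, the hypotheses say that \<open>v\<close> and \<open>v'\<close> are
  independent modulo \<open>W\<close>. A basis of \<open>W\<close> together with both vectors thus
  extends to a basis of the space, and \<open>T\<close> transposes the two basis vectors.\<close>

lemma swap_automorphism:
  assumes W: "vec.subspace (W :: (bit ^ 'n) set)"
    and v: "v \<notin> W" "v' \<notin> W" "v + v' \<notin> W"
  obtains T where "Vector_Spaces.linear (*s) (*s) T" "\<And>x. T (T x) = x" "\<And>w. w \<in> W \<Longrightarrow> T w = w"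
    "T v = v'" "T v' = v"
proof -
  obtain B where B: "B \<subseteq> W" "vec.independent B" "W \<subseteq> vec.span B"
    by (rule vec.maximal_independent_subset)
  then have spB: "vec.span B = W"
    using W by (metis vec.span_subspace)
  have "vec.independent (insert v B)"
    using B v spB by (simp add: vec.independent_insertI)
  \<comment> \<open>\<open>v'\<close> avoids this span because neither \<open>v'\<close> nor
    \<open>v + v'\<close> lies in \<open>W\<close>.\<close>
  moreover have "vec.span (insert v B) \<subseteq> extend W v"
    using W B v by (intro vec.span_minimal subspace_extend) (auto simp: extend_def subspace_bit_iff)
  then have "v' \<notin> vec.span (insert v B)"
    using v by (auto simp: extend_def)
  ultimately have ind: "vec.independent (insert v' (insert v B))"
    by (simp add: vec.independent_insertI)
  define D where "D = vec.extend_basis (insert v' (insert v B))"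
  have D: "insert v' (insert v B) \<subseteq> D" "vec.independent D" "vec.span D = UNIV"
    unfolding D_def using ind vec.extend_basis_superset vec.independent_extend_basis
      vec.span_extend_basis by blast+
  obtain T where T: "Vector_Spaces.linear (*s) (*s) T"
      "\<forall>x\<in>D. T x = (if x = v then v' else if x = v' then v else x)"
    using vec.linear_independent_extend[OF D(2), where f = "\<lambda>x. if x = v then v' else if x = v' then v else x"] by blast
  have lid: "Vector_Spaces.linear (*s) (*s) (\<lambda>x :: bit ^ 'n. x)"
    by (simp add: Vector_Spaces.linear_iff vec.vector_space_axioms)
  have TT: "Vector_Spaces.linear (*s) (*s) (\<lambda>x. T (T x))"
    using T(1) by (simp add: Vector_Spaces.linear_iff)
  show thesis
  proof
    show "Vector_Spaces.linear (*s) (*s) T" by (rule T)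
    show "T (T x) = x" for x
      by (rule vec.linear_eq_on[OF TT lid, of x D]) (use D T(2) in auto)
    show "T w = w" if "w \<in> W" for w
      by (rule vec.linear_eq_on[OF T(1) lid, of w B]) (use that spB D T(2) v(1,2) B(1) in \<open>force+\<close>)
    show "T v = v'" "T v' = v" using D T(2) by auto
  qed
qed

text \<open>If \<open>v + v' \<in> W\<close>, both extensions coincide; otherwise composition with
  the swap is a bijection. Hence every choice of \<open>v\<close> carries equal weight when
  averaging.\<close>

lemma card_surj_vanishing_extend_eq:
  assumes W: "vec.subspace (W :: (bit ^ 'm) set)" and v: "v \<notin> W" "v' \<notin> W"
  shows "card (surj_vanishing (extend W v) :: (bit ^ 'm \<Rightarrow> bit ^ 'n) set)
       = card (surj_vanishing (extend W v') :: (bit ^ 'm \<Rightarrow> bit ^ 'n) set)"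
proof (cases "v + v' \<in> W")
  case True
  have "v + x = (v + v') + (v' + x)" for x
    by (simp add: algebra_simps)
  then have "v + x \<in> W \<longleftrightarrow> v' + x \<in> W" for x
    using True W by (metis subspace_add_iff(1))
  then show ?thesis by (simp add: extend_def)
next
  case False
  obtain T where T: "Vector_Spaces.linear (*s) (*s) T" "\<And>x. T (T x) = x"
      "\<And>w. w \<in> W \<Longrightarrow> T w = w" "T v = v'" "T v' = v"
    using swap_automorphism[OF W v False] by metis
  have surjT: "surj T" by (rule surjI[of T T]) (rule T)
  have comp: "h \<circ> T \<in> surj_linear_maps" if "h \<in> surj_linear_maps" for h :: "bit ^ 'm \<Rightarrow> bit ^ 'n"
    using that Vector_Spaces.linear_compose[OF T(1)] comp_surj[OF surjT]
    unfolding surj_linear_maps_def by blast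
  have "bij_betw (\<lambda>h. h \<circ> T) (surj_vanishing (extend W v))
    (surj_vanishing (extend W v') :: (bit ^ 'm \<Rightarrow> bit ^ 'n) set)"
    unfolding surj_vanishing_extend[OF W]
    by (rule bij_betw_byWitness[where f' = "\<lambda>h. h \<circ> T"])
       (use T in \<open>auto simp: surj_vanishing_def linear_kernel_def comp fun_eq_iff\<close>)
  then show ?thesis by (rule bij_betw_same_card)
qed

text \<open>Double counting of pairs (v, h): each \<open>h\<close> occurs once for every kernel
  vector outside \<open>W\<close>, and their number is the same for all \<open>h\<close> because all
  kernels have the same size.\<close>

lemma sum_surj_vanishing_extend:
  fixes F :: "(bit ^ 'm \<Rightarrow> bit ^ 'n) \<Rightarrow> real"
  assumes W: "vec.subspace W"
  shows "(\<Sum>v\<in>-W. \<Sum>h\<in>surj_vanishing (extend W v). F h)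
       = (2 ^ CARD('m) / 2 ^ CARD('n) - real (card W)) * (\<Sum>h\<in>surj_vanishing W. F h)"
proof -
  have "(\<Sum>v\<in>-W. \<Sum>h\<in>surj_vanishing (extend W v). F h)
      = (\<Sum>v\<in>-W. \<Sum>h\<in>{h \<in> surj_vanishing W. h v = 0}. F h)"
    using W by (intro sum.cong) (auto simp: surj_vanishing_extend)
  also have "\<dots> = (\<Sum>h\<in>surj_vanishing W. \<Sum>v\<in>{v \<in> -W. h v = 0}. F h)"
    by (rule sum.swap_restrict) auto
  also have "\<dots> = (\<Sum>h\<in>surj_vanishing W. (2 ^ CARD('m) / 2 ^ CARD('n) - real (card W)) * F h)"
  proof (intro sum.cong refl)
    fix h :: "bit ^ 'm \<Rightarrow> bit ^ 'n" assume h: "h \<in> surj_vanishing W"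
    have sub: "W \<subseteq> linear_kernel h" using h by (simp add: surj_vanishing_def)
    have "real (card (linear_kernel h) * 2 ^ CARD('n)) = real (2 ^ CARD('m))"
      using h card_linear_kernel[of h] by (simp add: surj_vanishing_def)
    then have "real (card (linear_kernel h)) = 2 ^ CARD('m) / 2 ^ CARD('n)"
      by (simp add: field_simps)
    moreover have "{v \<in> -W. h v = 0} = linear_kernel h - W"
      by (auto simp: linear_kernel_def)
    ultimately show "(\<Sum>v\<in>{v \<in> -W. h v = 0}. F h) = (2 ^ CARD('m) / 2 ^ CARD('n) - real (card W)) * F h"
      using sub by (simp add: card_Diff_subset of_nat_diff card_mono)
  qed
  finally show ?thesis by (simp add: sum_distrib_left)
qed

section \<open>The exponential potential\<close>

text \<open>The number of points of \<open>S\<close> in the coset x + W: in characteristic 2,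
  \<open>x + s\<close> is the difference of x and s.\<close>

definition coset_load :: "(bit ^ 'n) set \<Rightarrow> (bit ^ 'n) set \<Rightarrow> bit ^ 'n \<Rightarrow> nat" where
  "coset_load S W x = card {s \<in> S. x + s \<in> W}"

text \<open>For a subspace \<open>W\<close> all cosets have equal size, so this mean over points is
  also the mean over cosets; the index set does not change when \<open>W\<close> grows.\<close>

definition potential :: "real \<Rightarrow> (bit ^ 'n) set \<Rightarrow> (bit ^ 'n) set \<Rightarrow> real" where
  "potential C S W = (\<Sum>x\<in>UNIV. C ^ coset_load S W x) / 2 ^ CARD('n)"

text \<open>A coset of the larger subspace is the disjoint union of two cosets of \<open>W\<close>.
  Exponentiation turns this sum into a product of two terms.\<close>

lemma coset_load_extend:
  assumes "vec.subspace W" "v \<notin> W"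
  shows "coset_load S (extend W v) x = coset_load S W x + coset_load S W (x + v)"
proof -
  have "{s \<in> S. x + s \<in> extend W v} = {s \<in> S. x + s \<in> W} \<union> {s \<in> S. (x + v) + s \<in> W}"
    by (auto simp: extend_def add_ac)
  moreover have "{s \<in> S. x + s \<in> W} \<inter> {s \<in> S. (x + v) + s \<in> W} = {}"
  proof -
    have "(x + v) + s \<notin> W" if "x + s \<in> W" for s
      using subspace_add_iff(2)[OF assms(1) that, of v] assms(2) by (simp add: add_ac)
    then show ?thesis by blast
  qed
  ultimately show ?thesis
    unfolding coset_load_def by (simp add: card_Un_disjoint)
qed

lemma coset_load_add:
  assumes "vec.subspace W" "w \<in> W"
  shows "coset_load S W (x + w) = coset_load S W x"
proof -
  have "(x + w) + s \<in> W \<longleftrightarrow> x + s \<in> W" for s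
    using subspace_add_iff(1)[OF assms, of "x + s"] by (simp add: add_ac)
  then show ?thesis by (simp add: coset_load_def)
qed

text \<open>Makes the logarithm of the potential nonnegative, as Markov's inequality
  requires.\<close>

lemma potential_ge_1:
  assumes "C \<ge> 1"
  shows "potential C (S :: (bit ^ 'n) set) W \<ge> 1"
proof -
  have "real (card (UNIV :: (bit ^ 'n) set)) * 1 \<le> (\<Sum>x\<in>UNIV. C ^ coset_load S W x)"
    by (rule sum_bounded_below) (use assms in auto)
  then show ?thesis by (simp add: potential_def)
qed

text \<open>Over all \<open>v\<close>, the sum of the products \<open>F x * F (x + v)\<close> factorises as a square. Omitting
  the \<open>v \<in> W\<close> removes a multiple of the sum of the \<open>(F x)\<^sup>2\<close>, which by Cauchy-Schwarz is at least the
  share of these \<open>v\<close>.\<close>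

lemma potential_extend_average:
  fixes S W :: "(bit ^ 'n) set"
  assumes W: "vec.subspace W"
  shows "(\<Sum>v\<in>-W. potential C S (extend W v)) \<le> real (card (-W)) * (potential C S W)\<^sup>2"
proof -
  define F where "F x = C ^ coset_load S W x" for x
  define A where "A = (\<Sum>x\<in>UNIV. F x)"
  define B where "B = (\<Sum>x\<in>UNIV. (F x)\<^sup>2)"
  define N :: real where "N = 2 ^ CARD('n)"
  have N: "N > 0" "real CARD(bit ^ 'n) = N" by (simp_all add: N_def)
  have shift: "(\<Sum>v\<in>UNIV. F (x + v)) = A" for x
    unfolding A_def by (rule sum.reindex_bij_betw[OF bij_add_left])
  have "(\<Sum>v\<in>UNIV. \<Sum>x\<in>UNIV. F x * F (x + v)) = (\<Sum>x\<in>UNIV. F x * (\<Sum>v\<in>UNIV. F (x + v)))"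
    by (subst sum.swap) (simp add: sum_distrib_left)
  also have "\<dots> = A\<^sup>2"
    by (simp add: shift power2_eq_square A_def sum_distrib_right)
  finally have all: "(\<Sum>v\<in>UNIV. \<Sum>x\<in>UNIV. F x * F (x + v)) = A\<^sup>2" .
  have inner: "(\<Sum>v\<in>W. \<Sum>x\<in>UNIV. F x * F (x + v)) = real (card W) * B"
    using W by (simp add: F_def coset_load_add B_def power2_eq_square)
  have "(\<Sum>v\<in>-W. potential C S (extend W v)) = (\<Sum>v\<in>-W. (\<Sum>x\<in>UNIV. F x * F (x + v)) / N)"
    using W by (intro sum.cong) (auto simp: potential_def coset_load_extend F_def power_add N_def)
  also have "\<dots> = (A\<^sup>2 - real (card W) * B) / N"
    using all inner by (simp add: sum_divide_distrib[symmetric] Compl_eq_Diff_UNIV sum_diff)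
  finally have lhs: "(\<Sum>v\<in>-W. potential C S (extend W v)) = (A\<^sup>2 - real (card W) * B) / N" .
  have "A\<^sup>2 \<le> N * B"
    using Cauchy_Schwarz_ineq_sum[of "\<lambda>_. 1" F "UNIV :: (bit ^ 'n) set"] N
    by (simp add: A_def B_def)
  then have "real (card W) * A\<^sup>2 \<le> real (card W) * (N * B)"
    by (intro mult_left_mono) auto
  then have "(A\<^sup>2 - real (card W) * B) * N \<le> (N - real (card W)) * A\<^sup>2"
    by (simp add: algebra_simps)
  then have "(A\<^sup>2 - real (card W) * B) / N \<le> (N - real (card W)) * (A / N)\<^sup>2"
    using N by (simp add: field_simps power2_eq_square)
  moreover have "real (card (-W)) = N - real (card W)"
    using N card_mono[of "UNIV :: (bit ^ 'n) set" W]
    by (simp add: Compl_eq_Diff_UNIV card_Diff_subset of_nat_diff)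
  ultimately show ?thesis
    unfolding lhs by (simp add: potential_def A_def F_def N_def)
qed

section \<open>The mean logarithm of the potential of a random kernel\<close>

text \<open>Jensen's inequality for \<open>ln\<close>, obtained from its tangent line at
  \<open>a\<close>, where \<open>a\<close> is an upper bound for the mean.\<close>

lemma sum_ln_le_ln_average:
  assumes "finite A" "\<And>x. x \<in> A \<Longrightarrow> f x > 0" "a > 0" "(\<Sum>x\<in>A. f x) \<le> real (card A) * a"
  shows "(\<Sum>x\<in>A. ln (f x)) \<le> real (card A) * ln a"
proof -
  have "(\<Sum>x\<in>A. ln (f x)) \<le> (\<Sum>x\<in>A. ln a + (f x / a - 1))"
  proof (rule sum_mono)
    fix x assume "x \<in> A"
    then have "f x > 0" by (rule assms(2))
    then show "ln (f x) \<le> ln a + (f x / a - 1)"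
      using assms(3) ln_le_minus_one[of "f x / a"] by (simp add: ln_div)
  qed
  also have "\<dots> = real (card A) * ln a + (\<Sum>x\<in>A. f x) / a - real (card A)"
    by (simp add: sum.distrib sum_subtractf sum_divide_distrib)
  also have "\<dots> \<le> real (card A) * ln a"
    using assms by (simp add: field_simps)
  finally show ?thesis .
qed

text \<open>Induction on the codimension \<open>j\<close> of \<open>W\<close> in the kernels. A
  random \<open>h\<close> with a random kernel vector outside \<open>W\<close> can be drawn in the
  other order: first \<open>v \<notin> W\<close>, then \<open>h\<close> vanishing on
  \<open>extend W v\<close>. Each enlargement at most doubles the mean logarithm, whence
  \<open>2 ^ j\<close>.\<close>

lemma sum_ln_potential_kernel_le:
  fixes S W :: "(bit ^ 'm) set"
  assumes "C \<ge> 1" "vec.subspace W" "2 ^ j * card W * 2 ^ CARD('n) = 2 ^ CARD('m)"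
  shows "(\<Sum>h\<in>(surj_vanishing W :: (bit ^ 'm \<Rightarrow> bit ^ 'n) set). ln (potential C S (linear_kernel h)))
    \<le> real (card (surj_vanishing W :: (bit ^ 'm \<Rightarrow> bit ^ 'n) set)) * 2 ^ j * ln (potential C S W)"
  using assms(2,3)
proof (induction j arbitrary: W)
  case 0
  have "linear_kernel h = W" if "h \<in> surj_vanishing W" for h :: "bit ^ 'm \<Rightarrow> bit ^ 'n"
  proof -
    have "card (linear_kernel h) * 2 ^ CARD('n) = card W * 2 ^ CARD('n)"
      using that 0 card_linear_kernel[of h] by (simp add: surj_vanishing_def)
    then show ?thesis
      using that card_subset_eq[of "linear_kernel h" W] by (simp add: surj_vanishing_def)
  qed
  then show ?case by simp
next
  case (Suc j)
  let ?H = "surj_vanishing :: (bit ^ 'm) set \<Rightarrow> (bit ^ 'm \<Rightarrow> bit ^ 'n) set"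
  let ?L = "\<lambda>V. ln (potential C S V)"
  \<comment> \<open>The number of vectors outside \<open>W\<close> in the kernel of any
    \<open>h\<close> in \<open>?H W\<close>.\<close>
  define K :: real where "K = 2 ^ CARD('m) / 2 ^ CARD('n) - real (card W)"
  have "real (2 ^ Suc j * card W * 2 ^ CARD('n)) = real (2 ^ CARD('m))"
    using Suc.prems by simp
  then have "(2::real) ^ CARD('m) / 2 ^ CARD('n) = 2 ^ Suc j * real (card W)"
    by (simp add: field_simps)
  then have K_eq: "K = (2 ^ Suc j - 1) * real (card W)"
    by (simp add: K_def algebra_simps)
  have "card W > 0"
    using Suc.prems by (auto simp: subspace_bit_iff card_gt_0_iff)
  moreover have "(2::real) ^ Suc j > 1" by (rule one_less_power) auto
  ultimately have "K > 0"
    unfolding K_eq by simp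
  have pos: "potential C S V > 0" for V :: "(bit ^ 'm) set"
    using potential_ge_1[OF assms(1), of S V] by simp
  obtain c where c: "card (?H (extend W v)) = c" if "v \<notin> W" for v
    using card_surj_vanishing_extend_eq[OF Suc.prems(1)] by metis
  \<comment> \<open>Double counting with constant weight 1 determines the common count
    \<open>c\<close>.\<close>
  have count: "real (card (-W)) * real c = K * real (card (?H W))"
    using sum_surj_vanishing_extend[OF Suc.prems(1), of "\<lambda>_ :: bit ^ 'm \<Rightarrow> bit ^ 'n. 1"]
    by (simp add: c K_def)
  have "K * (\<Sum>h\<in>?H W. ?L (linear_kernel h))
      = (\<Sum>v\<in>-W. \<Sum>h\<in>?H (extend W v). ?L (linear_kernel h))"
    unfolding K_def by (rule sum_surj_vanishing_extend[OF Suc.prems(1), symmetric])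
  also have "\<dots> \<le> (\<Sum>v\<in>-W. real c * 2 ^ j * ?L (extend W v))"
  proof (rule sum_mono)
    fix v assume "v \<in> -W"
    then have v: "v \<notin> W" by simp
    have "2 ^ j * card (extend W v) * 2 ^ CARD('n) = 2 ^ CARD('m)"
      using Suc.prems v by (simp add: card_extend algebra_simps)
    from Suc.IH[OF subspace_extend[OF Suc.prems(1)] this]
    show "(\<Sum>h\<in>?H (extend W v). ?L (linear_kernel h)) \<le> real c * 2 ^ j * ?L (extend W v)"
      using c[OF v] by simp
  qed
  also have "\<dots> = real c * 2 ^ j * (\<Sum>v\<in>-W. ?L (extend W v))"
    by (simp add: sum_distrib_left)
  \<comment> \<open>Jensen with \<open>a\<close> the squared potential of \<open>W\<close>; the
    square supplies the doubling.\<close>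
  also have "\<dots> \<le> real c * 2 ^ j * (real (card (-W)) * ln ((potential C S W)\<^sup>2))"
    by (intro mult_left_mono sum_ln_le_ln_average potential_extend_average)
       (simp_all add: pos less_imp_neq[OF pos, symmetric] Suc.prems)
  also have "\<dots> = real (card (-W)) * real c * (2 ^ Suc j * ?L W)"
    by (simp add: ln_realpow)
  also have "\<dots> = K * (real (card (?H W)) * 2 ^ Suc j * ?L W)"
    unfolding count by simp
  finally show ?case
    using \<open>K > 0\<close> by simp
qed

text \<open>Cosets of the zero subspace are singletons, so every load is 0 or 1.\<close>

lemma potential_zero_subspace:
  "potential C (S :: (bit ^ 'n) set) {0} = 1 + (C - 1) * real (card S) / 2 ^ CARD('n)"
proof -
  have "{s \<in> S. x + s \<in> {0}} = (if x \<in> S then {x} else {})" for x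
    by (auto simp: bit_vec_add_eq_0_iff)
  then have "C ^ coset_load S {0} x = 1 + (C - 1) * of_bool (x \<in> S)" for x
    by (simp add: coset_load_def)
  then have "(\<Sum>x\<in>UNIV. C ^ coset_load S {0} x) = 2 ^ CARD('n) + (C - 1) * real (card S)"
    by (simp add: sum.distrib sum_distrib_left[symmetric] of_bool_def sum.If_cases)
  then show ?thesis
    by (simp add: potential_def field_simps)
qed

text \<open>All points of the fullest fibre carry the maximum load. This fibre is a coset of the
  kernel, a fraction \<open>1 / 2 ^ CARD('n)\<close> of the space, and the other terms are
  nonnegative.\<close>

lemma power_max_load_le_potential:
  fixes h :: "bit ^ 'm \<Rightarrow> bit ^ 'n"
  assumes h: "h \<in> surj_linear_maps" and C: "C \<ge> 1"
  shows "C ^ max_load S h \<le> 2 ^ CARD('n) * potential C S (linear_kernel h)"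
proof -
  let ?K = "linear_kernel h"
  have "max_load S h \<in> range (\<lambda>y. card (h -` {y} \<inter> S))"
    unfolding max_load_def by (rule Max_in) auto
  then obtain y where y: "max_load S h = card (h -` {y} \<inter> S)" by auto
  obtain x where x: "h x = y"
    using h by (auto simp: surj_linear_maps_def surj_def) metis
  have "{s \<in> S. x + s \<in> ?K} = h -` {y} \<inter> S"
    using h x by (auto simp: linear_kernel_def surj_linear_maps_add bit_vec_add_eq_0_iff)
  then have load: "coset_load S ?K (x + k) = max_load S h" if "k \<in> ?K" for k
    using that coset_load_add[OF subspace_linear_kernel[OF h]] y by (simp add: coset_load_def)
  have "real (card ?K) * C ^ max_load S h = (\<Sum>z\<in>(+) x ` ?K. C ^ coset_load S ?K z)"
    by (simp add: sum.reindex load)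
  also have "\<dots> \<le> (\<Sum>z\<in>UNIV. C ^ coset_load S ?K z)"
    by (rule sum_mono2) (use C in auto)
  also have "\<dots> = real (2 ^ CARD('m)) * potential C S ?K"
    by (simp add: potential_def)
  also have "\<dots> = real (card ?K) * (2 ^ CARD('n) * potential C S ?K)"
    unfolding card_linear_kernel[OF h, symmetric] by simp
  finally show ?thesis
    using card_linear_kernel[OF h] by (auto simp: mult_le_cancel_left)
qed

text \<open>Start from the zero subspace and apply ln (1 + t) \<le> t: the factor
  \<open>2 ^ ?d\<close> from the doublings cancels the density of \<open>S\<close>, leaving
  \<open>C - 1\<close>.\<close>

lemma sum_ln_potential_le:
  fixes S :: "(bit ^ 'm) set"
  assumes C: "C \<ge> 1" and le: "CARD('n) \<le> CARD('m)" and S: "card S = 2 ^ CARD('n)"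
  shows "(\<Sum>h\<in>(surj_linear_maps :: (bit ^ 'm \<Rightarrow> bit ^ 'n) set). ln (potential C S (linear_kernel h)))
    \<le> real (card (surj_linear_maps :: (bit ^ 'm \<Rightarrow> bit ^ 'n) set)) * (C - 1)"
proof -
  let ?H = "surj_linear_maps :: (bit ^ 'm \<Rightarrow> bit ^ 'n) set"
  let ?d = "CARD('m) - CARD('n)"
  have H: "surj_vanishing {0} = ?H"
    by (auto simp: surj_vanishing_def linear_kernel_def surj_linear_maps_0)
  have pw: "(2::nat) ^ ?d * 2 ^ CARD('n) = 2 ^ CARD('m)"
    using le by (simp add: power_add[symmetric])
  have "2 ^ ?d * card {0 :: bit ^ 'm} * 2 ^ CARD('n) = 2 ^ CARD('m)"
    using pw by simp
  from sum_ln_potential_kernel_le[OF C vec.subspace_single_0 this, of S]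
  have "(\<Sum>h\<in>?H. ln (potential C S (linear_kernel h)))
      \<le> real (card ?H) * (2 ^ ?d * ln (potential C S {0}))"
    by (simp add: H mult.assoc)
  also have "\<dots> \<le> real (card ?H) * (2 ^ ?d * ((C - 1) * 2 ^ CARD('n) / 2 ^ CARD('m)))"
    using C by (intro mult_left_mono) (auto simp: potential_zero_subspace S intro!: ln_add_one_self_le_self)
  also have "\<dots> = real (card ?H) * (C - 1)"
    using arg_cong[OF pw, of real] by (simp add: field_simps)
  finally show ?thesis .
qed

section \<open>Tail bound for the maximum load\<close>

lemma prob_max_load_le:
  fixes S :: "(bit ^ 'm) set"
  assumes le: "CARD('n) \<le> CARD('m)" and S: "card S = 2 ^ CARD('n)"
    and l: "CARD('n) \<ge> 2" and r: "r > 1"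
  shows "measure_pmf.prob (pmf_of_set (surj_linear_maps :: (bit ^ 'm \<Rightarrow> bit ^ 'n) set))
      {h. real (max_load S h) \<ge> r * (real CARD('n) / log 2 (real CARD('n)))}
    \<le> log 2 (exp 1) / (r - 1)"
proof -
  let ?H = "surj_linear_maps :: (bit ^ 'm \<Rightarrow> bit ^ 'n) set"
  define l where "l = real CARD('n)"
  define E where "E = {h :: bit ^ 'm \<Rightarrow> bit ^ 'n. real (max_load S h) \<ge> r * (l / log 2 l)}"
  have l2: "l \<ge> 2" using l by (simp add: l_def)
  have ne: "?H \<noteq> {}" by (rule surj_linear_maps_nonempty[OF le])
  have pos: "potential l S V \<ge> 1" for V
    using l2 by (intro potential_ge_1) auto
  \<comment> \<open>With base C = l, the factor \<open>ln l\<close> cancels the denominator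
    \<open>log 2 l\<close> of the threshold. The loss \<open>l * ln 2\<close> from the factor
    \<open>2 ^ CARD('n)\<close> turns r into r - 1.\<close>
  have lnpot: "(r - 1) * l * ln 2 \<le> ln (potential l S (linear_kernel h))" if h: "h \<in> ?H \<inter> E" for h
  proof -
    have "r * l * ln 2 \<le> real (max_load S h) * ln l"
      using h l2 by (simp add: E_def log_def field_simps)
    also have "\<dots> = ln (l ^ max_load S h)"
      using l2 by (simp add: ln_realpow)
    also have "\<dots> \<le> ln (2 ^ CARD('n) * potential l S (linear_kernel h))"
    proof (rule ln_mono)
      show "l ^ max_load S h \<le> 2 ^ CARD('n) * potential l S (linear_kernel h)"
        using h l2 by (intro power_max_load_le_potential) auto
    qed (use l2 in simp)
    also have "\<dots> = l * ln 2 + ln (potential l S (linear_kernel h))"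
      using pos[of "linear_kernel h"] by (simp add: ln_mult ln_realpow l_def)
    finally show ?thesis by (simp add: algebra_simps)
  qed
  have "real (card (?H \<inter> E)) * ((r - 1) * l * ln 2) \<le> (\<Sum>h\<in>?H \<inter> E. ln (potential l S (linear_kernel h)))"
    by (rule sum_bounded_below) (rule lnpot)
  \<comment> \<open>Markov's inequality: the terms outside \<open>E\<close> are nonnegative.\<close>
  also have "\<dots> \<le> (\<Sum>h\<in>?H. ln (potential l S (linear_kernel h)))"
    by (rule sum_mono2) (use pos in auto)
  also have "\<dots> \<le> real (card ?H) * (l - 1)"
    using l2 by (intro sum_ln_potential_le le S) auto
  also have "\<dots> \<le> real (card ?H) * l"
    by (intro mult_left_mono) auto
  finally have "l * (real (card (?H \<inter> E)) * ((r - 1) * ln 2)) \<le> l * real (card ?H)"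
    by (simp add: mult_ac)
  then have "real (card (?H \<inter> E)) * ((r - 1) * ln 2) \<le> real (card ?H)"
    using l2 by simp
  moreover have "real (card ?H) > 0" using ne by (simp add: card_gt_0_iff)
  moreover have "(r - 1) * ln 2 > 0" using r by simp
  ultimately have "real (card (?H \<inter> E)) / real (card ?H) \<le> 1 / ((r - 1) * ln 2)"
    by (simp add: pos_le_divide_eq pos_divide_le_eq)
  then have "measure_pmf.prob (pmf_of_set ?H) E \<le> log 2 (exp 1) / (r - 1)"
    using ne by (simp add: measure_pmf_of_set log_def mult.commute)
  then show ?thesis by (simp add: E_def l_def)
qed

section \<open>Degenerate parameters and the bound in extended reals\<close>

theorem theorem4p4:
  fixes S :: "(bit ^ 'u) set"
    and l u n :: nat
    and r :: real
  assumes "l = CARD('l::finite)"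
    and "u = CARD('u)"
    and "real u \<ge> real l + log 2 (real l)"
    and "n = 2 ^ l"
    and "card S = n"
    and "r \<ge> 1"
  shows "ereal (measure_pmf.prob (pmf_of_set (surj_linear_maps :: (bit ^ 'u \<Rightarrow> bit ^ 'l) set))
            {h. ereal (real (max_load S h)) \<ge> ereal r * load_scale n})
         \<le> ereal (3 * log 2 (exp 1)) / ereal (2 * (r - 1))"
proof -
  have "CARD('l) \<ge> 1" by (simp add: Suc_le_eq)
  then have "log 2 (real l) \<ge> 0"
    using assms(1) by simp
  then have le: "CARD('l) \<le> CARD('u)"
    using assms(1-3) by linarith
  have rhs_nonneg: "ereal (3 * log 2 (exp 1)) / ereal (2 * (r - 1)) \<ge> 0"
    using assms(6) by (simp add: log_def divide_ereal_def)
  have logn: "log 2 (real n) = real l"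
    using assms(4) by (simp add: log_nat_power)
  \<comment> \<open>For l = 1 the scale is 1/0 = \<infinity>, so the event is empty; for r = 1 the
    right-hand side is \<infinity>. Otherwise all quotients are finite.\<close>
  consider "CARD('l) = 1" | "CARD('l) \<ge> 2" "r = 1" | "CARD('l) \<ge> 2" "r > 1"
    using \<open>CARD('l) \<ge> 1\<close> assms(6) by linarith
  then show ?thesis
  proof cases
    case 1
    then have "load_scale n = \<infinity>"
      unfolding load_scale_def logn using assms(1) by (simp add: zero_ereal_def[symmetric] divide_ereal_def)
    then show ?thesis
      using rhs_nonneg assms(6) by simp
  next
    case 2
    then show ?thesis
      by (simp add: log_def zero_ereal_def[symmetric] divide_ereal_def)
  next
    case 3
    then have "log 2 (real CARD('l)) > 0"
      by simp
    then have nz: "log 2 (real CARD('l)) \<noteq> 0"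
      by linarith
    have "load_scale n = ereal (real CARD('l) / log 2 (real CARD('l)))"
      unfolding load_scale_def logn using assms(1) by (simp add: nz)
    then have "measure_pmf.prob (pmf_of_set (surj_linear_maps :: (bit ^ 'u \<Rightarrow> bit ^ 'l) set))
            {h. ereal (real (max_load S h)) \<ge> ereal r * load_scale n} \<le> log 2 (exp 1) / (r - 1)"
      using prob_max_load_le[OF le _ 3, of S] assms(1,4,5) by simp
    \<comment> \<open>The constant 1 obtained above is at most 3/2.\<close>
    also have "\<dots> \<le> 3 * log 2 (exp 1) / (2 * (r - 1))"
      using 3 by (simp add: log_def field_simps)
    finally show ?thesis
      using 3 by simp
  qed
qed

end
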